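(* Let $p\ge 1$ be an integer, let $q=2p+1$, and for $0\le n\le 2p+1$ let $f_n$ be the number of regions into which the disk is divided by the first $n$ segments of the circular billiard trajectory with angle $\vartheta=\frac{p}{2p+1}\cdot 2\pi$. Then for all integers $n$ with $0\le n\le 2p+1$, $$f_n = 2-(\delta_{n,0}+\delta_{n,2p+1})+\sum_{i=1}^{n-1} i = 2-(\delta_{n,0}+\delta_{n,2p+1})+\frac{n(n-1)}{2},$$ where $\delta_{i,j}$ is the Kronecker delta (and the sum is $0$ when $n\le 1$).
   Context: Circular billiard. Fix $R>0$ and let $D\subset\mathbb{R}^2$ be the open disk of radius $R$ centered at the origin. For positive integers $p,q$ with $\gcd(p,q)=1$ and $p/q<1/2$, put $P_i=\left(R\cos\frac{2\pi i}{q},\,R\sin\frac{2\pi i}{q}\right)$ for $i\in\mathbb{Z}$ (indices modulo $q$). The billiard trajectory with angle $\vartheta=\frac{p}{q}\cdot 2\pi$ started at $P_0$ successively traverses the closed straight segments $L_1,L_2,\dots,L_q$, where $L_j$ joins $P_{p(j-1)}$ to $P_{pj}$; after $q$ segments it returns to $P_0$. For $0\le n\le q$, $f_n$ denotes the number of regions into which the disk is divided after $n$ segments, i.e. the number of connected components of $D\setminus(L_1\cup\dots\cup L_n)$; in particular $f_0=1$. *)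

theory Defs
  imports "HOL-Analysis.Analysis"
begin

definition kronecker_delta :: "nat \<Rightarrow> nat \<Rightarrow> real" where
  "kronecker_delta i j = (if i = j then 1 else 0)"

definition billiard_point :: "real \<Rightarrow> nat \<Rightarrow> int \<Rightarrow> real ^ 2" where
  "billiard_point R q i =
     vector [R * cos (2 * pi * of_int i / real q), R * sin (2 * pi * of_int i / real q)]"

text \<open>The j-th segment (j = 1, 2, ...) of the trajectory with angle \<open>2 * pi * p / q\<close>.\<close>

definition billiard_segment :: "real \<Rightarrow> nat \<Rightarrow> nat \<Rightarrow> nat \<Rightarrow> (real ^ 2) set" where
  "billiard_segment R p q j =
     closed_segment (billiard_point R q (int p * (int j - 1))) (billiard_point R q (int p * int j))"

text \<open>As \<open>card\<close> of an infinite set is 0, a positive value also asserts that there are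
  only finitely many regions.\<close>

definition billiard_regions :: "real \<Rightarrow> nat \<Rightarrow> nat \<Rightarrow> nat \<Rightarrow> nat" where
  "billiard_regions R p q n =
     card (components (ball (0 :: real ^ 2) R - (\<Union>j\<in>{1..n}. billiard_segment R p q j)))"

end

theory Submission
  imports Defs
begin

text \<open>
  Inside the open disk each chord agrees with a line, so the regions correspond to the sign vectors
  realised by an arrangement of lines on the disk. Adding a line splits exactly the cells it meets,
  so the number of cells grows by the number of sign vectors realised on the new chord; applying the
  same principle in dimension one, this is one more than the number of crossings on that chord.

  All chords are tangent to one circle, so no three of them meet in a point. With half-angle
  \<open>\<alpha> = \<pi> p / q\<close>, chords \<open>j\<close> and \<open>m = j + k\<close> cross inside the disk iff
  \<open>cos 2\<alpha> < cos 2k\<alpha>\<close>, which for \<open>q = 2p + 1\<close> says \<open>1 < k < q - 1\<close>: consecutive chords (cyclically)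
  only share an endpoint on the boundary.
\<close>

section \<open>Sign vectors of hyperplane arrangements and how their number grows\<close>

text \<open>A sign vector is encoded as its set of positive indices; points on one of the
  hyperplanes are discarded. The ambient space and \<open>S\<close> stay general so that the same
  notion serves the disk, a chord of it and a real interval.\<close>

definition sign_cells ::
  "('i \<Rightarrow> 'a::real_inner) \<Rightarrow> ('i \<Rightarrow> real) \<Rightarrow> 'i set \<Rightarrow> 'a set \<Rightarrow> 'i set set" where
  "sign_cells a b J S = (\<lambda>x. {j\<in>J. b j < a j \<bullet> x}) ` {x\<in>S. \<forall>j\<in>J. a j \<bullet> x \<noteq> b j}"

text \<open>The points realising \<open>T\<close> form the trace on \<open>S\<close> of an
  intersection of open half-spaces. This form gives access to convexity and openness.\<close>

lemma mem_sign_cells: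
  "T \<in> sign_cells a b J S \<longleftrightarrow>
     T \<subseteq> J \<and> (\<exists>x\<in>S. (\<forall>j\<in>T. b j < a j \<bullet> x) \<and> (\<forall>j\<in>J - T. a j \<bullet> x < b j))"
proof
  assume "T \<in> sign_cells a b J S"
  then obtain x where x: "x \<in> S" "\<forall>j\<in>J. a j \<bullet> x \<noteq> b j" and T: "T = {j\<in>J. b j < a j \<bullet> x}"
    unfolding sign_cells_def by blast
  show "T \<subseteq> J \<and> (\<exists>x\<in>S. (\<forall>j\<in>T. b j < a j \<bullet> x) \<and> (\<forall>j\<in>J - T. a j \<bullet> x < b j))"
    by (intro conjI bexI[OF _ x(1)]) (use x(2) T in \<open>auto simp: less_le not_less\<close>)
next
  assume "T \<subseteq> J \<and> (\<exists>x\<in>S. (\<forall>j\<in>T. b j < a j \<bullet> x) \<and> (\<forall>j\<in>J - T. a j \<bullet> x < b j))"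
  then obtain x where x: "T \<subseteq> J" "x \<in> S" "\<forall>j\<in>T. b j < a j \<bullet> x" "\<forall>j\<in>J - T. a j \<bullet> x < b j"
    by blast
  have cases: "j \<in> T \<and> b j < a j \<bullet> x \<or> j \<notin> T \<and> a j \<bullet> x < b j" if "j \<in> J" for j
    using x that by blast
  have "T = {j\<in>J. b j < a j \<bullet> x}"
    using x(1,3) cases by (intro set_eqI) (auto dest: less_asym)
  moreover have "\<forall>j\<in>J. a j \<bullet> x \<noteq> b j"
    using cases by (metis order_less_irrefl)
  ultimately show "T \<in> sign_cells a b J S"
    unfolding sign_cells_def by (intro image_eqI[where x = x] CollectI conjI x(2))
qed

lemma sign_cells_subset: "sign_cells a b J S \<subseteq> Pow J"
  unfolding sign_cells_def by auto

lemma finite_sign_cells: "finite J \<Longrightarrow> finite (sign_cells a b J S)"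
  by (rule finite_subset[OF sign_cells_subset]) simp

lemma sign_cells_Un: "sign_cells a b J (S \<union> S') = sign_cells a b J S \<union> sign_cells a b J S'"
  unfolding sign_cells_def by (simp add: Collect_disj_eq conj_disj_distribR image_Un)

lemma sign_cells_empty_index: "S \<noteq> {} \<Longrightarrow> sign_cells a b {} S = {{}}"
  unfolding sign_cells_def by auto

lemma sign_cells_empty: "sign_cells a b J {} = {}"
  unfolding sign_cells_def by auto

text \<open>Only the values \<open>a j \<bullet> x - b j\<close> matter, so an arrangement on a
  parametrised set can be pulled back to the parameters. This later turns chords crossing a fixed
  chord into points of an interval.\<close>

lemma sign_cells_image:
  assumes "\<And>j s. j \<in> J \<Longrightarrow> s \<in> I \<Longrightarrow> a j \<bullet> \<gamma> s - b j = a' j \<bullet> s - b' j"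
  shows "sign_cells a b J (\<gamma> ` I) = sign_cells a' b' J I"
proof (rule set_eqI)
  fix T
  have *: "b j < a j \<bullet> \<gamma> s \<longleftrightarrow> b' j < a' j \<bullet> s" "a j \<bullet> \<gamma> s < b j \<longleftrightarrow> a' j \<bullet> s < b' j"
    if "j \<in> J" "s \<in> I" for j s
    using assms[OF that] by linarith+
  show "T \<in> sign_cells a b J (\<gamma> ` I) \<longleftrightarrow> T \<in> sign_cells a' b' J I"
  proof (cases "T \<subseteq> J")
    case True
    then show ?thesis
      unfolding mem_sign_cells bex_simps
      by (intro conj_cong refl bex_cong ball_cong) (auto simp: * subset_iff)
  qed (simp add: mem_sign_cells)
qed

lemma sign_cells_insert_split:
  assumes "m \<notin> J"
  shows "sign_cells a b (insert m J) S =
    sign_cells a b J (S \<inter> {x. a m \<bullet> x < b m}) \<union>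
    insert m ` sign_cells a b J (S \<inter> {x. b m < a m \<bullet> x})" (is "?L = ?A \<union> insert m ` ?B")
proof (intro equalityI subsetI)
  fix T assume "T \<in> ?L"
  then obtain x where x: "T \<subseteq> insert m J" "x \<in> S" "\<forall>j\<in>T. b j < a j \<bullet> x"
      "\<forall>j\<in>insert m J - T. a j \<bullet> x < b j"
    unfolding mem_sign_cells by blast
  show "T \<in> ?A \<union> insert m ` ?B"
  proof (cases "m \<in> T")
    case True
    have "T - {m} \<in> ?B"
      unfolding mem_sign_cells using x True assms by blast
    then show ?thesis
      using True by (metis UnI2 image_eqI insert_Diff)
  next
    case False
    have "T \<in> ?A"
      unfolding mem_sign_cells using x False assms by blast
    then show ?thesis by blast
  qed
next
  fix T assume "T \<in> ?A \<union> insert m ` ?B"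
  then show "T \<in> ?L"
  proof
    assume "T \<in> ?A"
    then show ?thesis
      unfolding mem_sign_cells using assms by blast
  next
    assume "T \<in> insert m ` ?B"
    then obtain U where U: "T = insert m U" "U \<in> ?B" by blast
    then obtain x where x: "U \<subseteq> J" "x \<in> S" "b m < a m \<bullet> x"
        "\<forall>j\<in>U. b j < a j \<bullet> x" "\<forall>j\<in>J - U. a j \<bullet> x < b j"
      unfolding mem_sign_cells by blast
    show ?thesis
      unfolding mem_sign_cells U(1)
      by (intro conjI bexI[where x = x]) (use x in auto)
  qed
qed

text \<open>A cell with points on both sides is convex, so the intermediate value theorem gives it a
  point on the hyperplane. Conversely a cell is open, since \<open>J\<close> is finite, so from a
  point on the hyperplane one can step to either side along the normal.\<close>

lemma sign_cells_hyperplane: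
  assumes "finite J" "open S" "convex S" "a m \<noteq> 0"
  shows "sign_cells a b J (S \<inter> {x. a m \<bullet> x < b m}) \<inter> sign_cells a b J (S \<inter> {x. b m < a m \<bullet> x})
    = sign_cells a b J (S \<inter> {x. a m \<bullet> x = b m})" (is "?A \<inter> ?B = ?C")
proof (intro equalityI subsetI)
  fix T assume "T \<in> ?A \<inter> ?B"
  then obtain x y where T: "T \<subseteq> J" and x: "x \<in> S" "a m \<bullet> x < b m" "\<forall>j\<in>T. b j < a j \<bullet> x"
      "\<forall>j\<in>J - T. a j \<bullet> x < b j"
    and y: "y \<in> S" "b m < a m \<bullet> y" "\<forall>j\<in>T. b j < a j \<bullet> y" "\<forall>j\<in>J - T. a j \<bullet> y < b j"
    unfolding Int_iff mem_sign_cells by blast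
  define K where "K = S \<inter> (\<Inter>j\<in>T. {z. a j \<bullet> z > b j}) \<inter> (\<Inter>j\<in>J-T. {z. a j \<bullet> z < b j})"
  have "convex K"
    unfolding K_def using assms(3)
    by (intro convex_Int convex_INT convex_halfspace_gt convex_halfspace_lt) auto
  moreover have "x \<in> K" "y \<in> K"
    unfolding K_def using x y by auto
  ultimately obtain z where "z \<in> K" "a m \<bullet> z = b m"
    using connected_ivt_hyperplane[of K x y "a m" "b m"] x y convex_connected by fastforce
  then show "T \<in> ?C"
    unfolding mem_sign_cells K_def using T by blast
next
  fix T assume "T \<in> ?C"
  then obtain x where T: "T \<subseteq> J" and x: "x \<in> S" "a m \<bullet> x = b m" "\<forall>j\<in>T. b j < a j \<bullet> x"
      "\<forall>j\<in>J - T. a j \<bullet> x < b j"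
    unfolding mem_sign_cells by blast
  define K where "K = S \<inter> (\<Inter>j\<in>T. {z. a j \<bullet> z > b j}) \<inter> (\<Inter>j\<in>J-T. {z. a j \<bullet> z < b j})"
  have "finite T" using T assms(1) finite_subset by blast
  then have "open K"
    unfolding K_def using assms(1,2)
    by (intro open_Int open_INT open_halfspace_gt open_halfspace_lt ballI) auto
  moreover have "x \<in> K" unfolding K_def using x by auto
  ultimately obtain e where e: "e > 0" "cball x e \<subseteq> K"
    using open_contains_cball by blast
  \<comment> \<open>With this scale the displacement \<open>t *\<^sub>R a m\<close> has norm exactly
    \<open>e\<close>, so both shifted points stay in the closed ball.\<close>
  define t where "t = e / norm (a m)"
  have t: "t > 0" using e assms(4) by (simp add: t_def)
  have aa: "t * (a m \<bullet> a m) > 0" using t assms(4) by simp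
  have "x + t *\<^sub>R a m \<in> cball x e" "x - t *\<^sub>R a m \<in> cball x e"
    using e assms(4) by (auto simp: dist_norm t_def)
  then have K: "x + t *\<^sub>R a m \<in> K" "x - t *\<^sub>R a m \<in> K" using e by auto
  have sides: "a m \<bullet> (x + t *\<^sub>R a m) > b m" "a m \<bullet> (x - t *\<^sub>R a m) < b m"
    using aa x(2) by (auto simp: inner_add_right inner_diff_right)
  have "T \<in> ?A"
    unfolding mem_sign_cells using T K(2) sides(2)
    by (intro conjI bexI[where x = "x - t *\<^sub>R a m"]) (auto simp: K_def)
  moreover have "T \<in> ?B"
    unfolding mem_sign_cells using T K(1) sides(1)
    by (intro conjI bexI[where x = "x + t *\<^sub>R a m"]) (auto simp: K_def)
  ultimately show "T \<in> ?A \<inter> ?B" by blast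
qed

text \<open>With \<open>A\<close> and \<open>B\<close> the cells over \<open>J\<close> seen below
  and above the new hyperplane, the new count is
  \<open>card A + card B = card (A \<union> B) + card (A \<inter> B)\<close>. The union consists of
  the old cells, the intersection of the cells on the hyperplane itself.\<close>

lemma card_sign_cells_insert:
  assumes "finite J" "m \<notin> J" "open S" "convex S" "a m \<noteq> 0"
  shows "card (sign_cells a b (insert m J) S) =
    card (sign_cells a b J S) + card (sign_cells a b J (S \<inter> {x. a m \<bullet> x = b m}))"
proof -
  let ?A = "sign_cells a b J (S \<inter> {x. a m \<bullet> x < b m})"
  let ?B = "sign_cells a b J (S \<inter> {x. b m < a m \<bullet> x})"
  let ?C = "sign_cells a b J (S \<inter> {x. a m \<bullet> x = b m})"
  have int: "?A \<inter> ?B = ?C"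
    by (rule sign_cells_hyperplane) (use assms in auto)
  \<comment> \<open>The points on the hyperplane contribute no further cells, because their cells
    are those in \<open>?A \<inter> ?B\<close>.\<close>
  have S: "S = (S \<inter> {x. a m \<bullet> x < b m}) \<union> (S \<inter> {x. b m < a m \<bullet> x}) \<union> (S \<inter> {x. a m \<bullet> x = b m})"
    by auto
  have "sign_cells a b J S = ?A \<union> ?B \<union> ?C"
    by (subst S) (simp only: sign_cells_Un)
  then have un: "sign_cells a b J S = ?A \<union> ?B"
    using int by blast
  have fin: "finite ?A" "finite ?B" using finite_sign_cells[OF assms(1)] by auto
  have m: "m \<notin> T" if "T \<in> ?A \<union> ?B" for T
    using that assms(2) sign_cells_subset by blast
  have inj: "inj_on (insert m) ?B"
    using m by (intro inj_onI) (metis Diff_insert_absorb UnCI)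
  have "card (sign_cells a b (insert m J) S) = card ?A + card (insert m ` ?B)"
    unfolding sign_cells_insert_split[OF assms(2)]
    by (rule card_Un_disjoint) (use fin m in auto)
  also have "\<dots> = card ?A + card ?B"
    by (simp add: card_image[OF inj])
  also have "\<dots> = card (?A \<union> ?B) + card (?A \<inter> ?B)"
    by (rule card_Un_Int[OF fin])
  finally show ?thesis
    by (simp only: un int)
qed

text \<open>In dimension one the hyperplane of index \<open>j\<close> is the single point
  \<open>b j / a j\<close>. By the insertion formula each such point inside the interval adds one
  cell, provided that no two of them coincide there.\<close>

lemma card_sign_cells_interval:
  fixes a b :: "'i \<Rightarrow> real"
  assumes "finite J" "l < u" "\<And>j. j \<in> J \<Longrightarrow> a j \<noteq> 0"
    and "inj_on (\<lambda>j. b j / a j) {j\<in>J. b j / a j \<in> {l<..<u}}"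
  shows "card (sign_cells a b J {l<..<u}) = Suc (card {j\<in>J. b j / a j \<in> {l<..<u}})"
  using assms(1,3,4)
proof (induction J rule: finite_induct)
  case empty
  then show ?case using assms(2) by (simp add: sign_cells_empty_index)
next
  case (insert m J)
  let ?r = "b m / a m"
  have am: "a m \<noteq> 0" using insert.prems by auto
  have IH: "card (sign_cells a b J {l<..<u}) = Suc (card {j\<in>J. b j / a j \<in> {l<..<u}})"
    by (rule insert.IH) (use insert.prems in \<open>auto elim: inj_on_subset\<close>)
  have step: "card (sign_cells a b (insert m J) {l<..<u}) =
      card (sign_cells a b J {l<..<u}) + card (sign_cells a b J ({l<..<u} \<inter> {x. a m \<bullet> x = b m}))"
    by (rule card_sign_cells_insert) (use insert.hyps am in auto)
  have root: "{x. a m \<bullet> x = b m} = {?r}"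
    using am by (auto simp: field_simps)
  show ?case
  proof (cases "?r \<in> {l<..<u}")
    case True
    then have "{l<..<u} \<inter> {x. a m \<bullet> x = b m} = {?r}" using root by auto
    \<comment> \<open>Distinct roots keep the new point off all earlier hyperplanes, so it realises
      exactly one sign vector.\<close>
    moreover have "a j * ?r \<noteq> b j" if j: "j \<in> J" for j
    proof
      assume *: "a j * ?r = b j"
      have "a j \<noteq> 0" using insert.prems(1) j by auto
      then have "b j / a j = ?r" using * by (simp add: field_simps)
      then have "j = m"
        using insert.prems(2) True j by (auto simp: inj_on_def)
      then show False using j insert.hyps by auto
    qed
    then have "sign_cells a b J {?r} = {{j\<in>J. b j < a j \<bullet> ?r}}"
      unfolding sign_cells_def by auto
    moreover have "{j\<in>insert m J. b j / a j \<in> {l<..<u}} = insert m {j\<in>J. b j / a j \<in> {l<..<u}}"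
      using True by auto
    ultimately show ?thesis
      using step IH insert.hyps by simp
  next
    case False
    then have "{l<..<u} \<inter> {x. a m \<bullet> x = b m} = {}" using root by auto
    moreover have "{j\<in>insert m J. b j / a j \<in> {l<..<u}} = {j\<in>J. b j / a j \<in> {l<..<u}}"
      using False by auto
    ultimately show ?thesis
      using step IH by (simp add: sign_cells_empty)
  qed
qed

section \<open>From connected components to sign vectors\<close>

text \<open>A connected set avoiding all hyperplanes cannot change sign, so each component lies in
  one cell; each cell is convex, hence connected, and so fills the component.\<close>

lemma card_components_sign_cells:
  fixes a :: "'i \<Rightarrow> 'a::euclidean_space"
  assumes "convex S"
  shows "card (components (S - (\<Union>j\<in>J. {x. a j \<bullet> x = b j}))) = card (sign_cells a b J S)"
proof -
  define X where "X = {x\<in>S. \<forall>j\<in>J. a j \<bullet> x \<noteq> b j}"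
  define sv where "sv x = {j\<in>J. b j < a j \<bullet> x}" for x
  define cell where "cell T = {y\<in>X. sv y = T}" for T
  have comp: "connected_component_set X x = cell (sv x)" if x: "x \<in> X" for x
  proof
    \<comment> \<open>One inclusion suffices: exchanging \<open>y\<close> and \<open>z\<close>
      yields equality of the two sign vectors.\<close>
    have sub: "sv y \<subseteq> sv z" if U: "connected U" "U \<subseteq> X" "z \<in> U" "y \<in> U" for U y z
    proof
      fix j assume j: "j \<in> sv y"
      show "j \<in> sv z"
      proof (rule ccontr)
        assume "j \<notin> sv z"
        then have "a j \<bullet> z \<le> b j" "b j \<le> a j \<bullet> y" using j by (auto simp: sv_def)
        then obtain w where "w \<in> U" "a j \<bullet> w = b j"
          using connected_ivt_hyperplane[OF U(1,3,4)] by blast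
        then show False using j U(2) by (auto simp: X_def sv_def)
      qed
    qed
    show "connected_component_set X x \<subseteq> cell (sv x)"
      using sub by (fastforce simp: connected_component_def cell_def)
    have "cell (sv x) = S \<inter> (\<Inter>j\<in>sv x. {z. a j \<bullet> z > b j}) \<inter> (\<Inter>j\<in>J-sv x. {z. a j \<bullet> z < b j})"
      (is "_ = ?H")
    proof (intro equalityI subsetI)
      fix y assume "y \<in> cell (sv x)"
      then have y: "y \<in> S" "\<forall>j\<in>J. a j \<bullet> y \<noteq> b j" "{j\<in>J. b j < a j \<bullet> y} = sv x"
        by (auto simp: cell_def X_def sv_def)
      then have "b j < a j \<bullet> y" if "j \<in> sv x" for j
        using that by blast
      moreover have "a j \<bullet> y < b j" if "j \<in> J - sv x" for j
        using that y by (metis (mono_tags, lifting) DiffE linorder_neqE_linordered_idom mem_Collect_eq)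
      ultimately show "y \<in> ?H" using y(1) by blast
    next
      fix y assume y: "y \<in> ?H"
      have "sv x \<subseteq> J" by (auto simp: sv_def)
      then have "sv y = sv x" "\<forall>j\<in>J. a j \<bullet> y \<noteq> b j"
        unfolding sv_def[of y] using y by force+
      then show "y \<in> cell (sv x)"
        using y by (auto simp: cell_def X_def)
    qed
    then have "convex (cell (sv x))"
      using assms
      by (auto intro!: convex_Int convex_INT convex_halfspace_gt convex_halfspace_lt)
    then show "cell (sv x) \<subseteq> connected_component_set X x"
      by (intro connected_component_maximal convex_connected) (use x in \<open>auto simp: cell_def\<close>)
  qed
  have "components X = cell ` sv ` X"
    unfolding components_def image_image using comp by (intro image_cong) auto
  moreover have "inj_on cell (sv ` X)"
    by (intro inj_onI) (fastforce simp: cell_def)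
  ultimately have "card (components X) = card (sv ` X)"
    by (simp add: card_image)
  moreover have "S - (\<Union>j\<in>J. {x. a j \<bullet> x = b j}) = X"
    by (auto simp: X_def)
  ultimately show ?thesis
    by (simp add: sign_cells_def X_def sv_def)
qed

section \<open>Chords of the disk in polar form\<close>

definition dir :: "real \<Rightarrow> real ^ 2" where
  "dir \<phi> = vector [cos \<phi>, sin \<phi>]"

text \<open>This is \<open>dir \<phi>\<close> turned by a quarter turn. The two vectors form an
  orthonormal frame: the normal and the direction of a chord whose midpoint lies on the line through
  the centre at angle \<open>\<phi>\<close>.\<close>

definition perp :: "real \<Rightarrow> real ^ 2" where
  "perp \<phi> = vector [- sin \<phi>, cos \<phi>]"

lemma inner_dir_dir: "dir \<phi> \<bullet> dir \<psi> = cos (\<phi> - \<psi>)"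
  by (simp add: dir_def inner_vec_def sum_2 cos_diff)

lemma inner_dir_perp: "dir \<phi> \<bullet> perp \<psi> = sin (\<phi> - \<psi>)"
  by (simp add: dir_def perp_def inner_vec_def sum_2 sin_diff)

lemma dir_nonzero: "dir \<phi> \<noteq> 0"
  using inner_dir_dir[of \<phi> \<phi>] by auto

lemma dir_add: "dir (\<phi> + \<alpha>) = cos \<alpha> *\<^sub>R dir \<phi> + sin \<alpha> *\<^sub>R perp \<phi>"
  by (simp add: dir_def perp_def vec_eq_iff forall_2 cos_add sin_add algebra_simps)

lemma dir_diff: "dir (\<phi> - \<alpha>) = cos \<alpha> *\<^sub>R dir \<phi> - sin \<alpha> *\<^sub>R perp \<phi>"
  using dir_add[of \<phi> "- \<alpha>"] by simp

lemma dir_perp_expansion: "x = (dir \<phi> \<bullet> x) *\<^sub>R dir \<phi> + (perp \<phi> \<bullet> x) *\<^sub>R perp \<phi>"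
proof -
  \<comment> \<open>Coordinate form of the claim, with \<open>c\<close>, \<open>s\<close> for cosine
    and sine and \<open>u\<close>, \<open>v\<close> for the entries of \<open>x\<close>; it is
    polynomial up to the relation \<open>s\<^sup>2 + c\<^sup>2 = 1\<close>.\<close>
  have *: "u = (c * u + s * v) * c - (c * v - s * u) * s"
          "v = (c * u + s * v) * s + (c * v - s * u) * c" if "s\<^sup>2 + c\<^sup>2 = 1" for c s u v :: real
  proof -
    have "(c * u + s * v) * c - (c * v - s * u) * s = u * (s\<^sup>2 + c\<^sup>2)"
         "(c * u + s * v) * s + (c * v - s * u) * c = v * (s\<^sup>2 + c\<^sup>2)"
      by (simp_all add: power2_eq_square algebra_simps)
    then show "u = (c * u + s * v) * c - (c * v - s * u) * s"
          "v = (c * u + s * v) * s + (c * v - s * u) * c" by (simp_all add: that)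
  qed
  show ?thesis
    using *[OF sin_cos_squared_add[of \<phi>], where u = "x $ 1" and v = "x $ 2"]
    by (simp add: dir_def perp_def vec_eq_iff forall_2 inner_vec_def sum_2)
qed

lemma norm_dir_perp: "(norm (c *\<^sub>R dir \<phi> + s *\<^sub>R perp \<phi>))\<^sup>2 = c\<^sup>2 + s\<^sup>2"
proof -
  have "dir \<phi> \<bullet> dir \<phi> = 1" "dir \<phi> \<bullet> perp \<phi> = 0" "perp \<phi> \<bullet> perp \<phi> = 1"
    by (simp_all add: inner_dir_dir inner_dir_perp)
       (simp add: perp_def inner_vec_def sum_2 flip: power2_eq_square)
  then show ?thesis
    unfolding power2_norm_eq_inner
    by (simp add: inner_add_left inner_add_right inner_commute[of "perp \<phi>" "dir \<phi>"] power2_eq_square)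
qed

text \<open>By Pythagoras, a line at signed distance \<open>R * cos \<alpha>\<close> from the centre
  cuts out a chord of half-length \<open>R * sin \<alpha>\<close>.\<close>

lemma ball_inter_line:
  fixes R \<alpha> \<phi> :: real
  assumes "R > 0" "0 < \<alpha>" "\<alpha> < pi"
  shows "ball 0 R \<inter> {x. dir \<phi> \<bullet> x = R * cos \<alpha>} =
    (\<lambda>s. (R * cos \<alpha>) *\<^sub>R dir \<phi> + s *\<^sub>R perp \<phi>) ` {- (R * sin \<alpha>)<..<R * sin \<alpha>}"
    (is "?L = ?\<gamma> ` ?I")
proof -
  have sin: "sin \<alpha> > 0" using assms sin_gt_zero by blast
  have in_ball: "?\<gamma> s \<in> ball 0 R \<longleftrightarrow> s \<in> ?I" for s
  proof -
    have "norm (?\<gamma> s) < R \<longleftrightarrow> (norm (?\<gamma> s))\<^sup>2 < R\<^sup>2"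
      using assms(1) by (simp add: abs_le_square_iff[symmetric] flip: not_le)
    also have "\<dots> \<longleftrightarrow> (R * cos \<alpha>)\<^sup>2 + s\<^sup>2 < R\<^sup>2"
      by (simp only: norm_dir_perp)
    also have "\<dots> \<longleftrightarrow> s\<^sup>2 < (R * sin \<alpha>)\<^sup>2"
      by (simp add: power_mult_distrib sin_squared_eq algebra_simps)
    also have "\<dots> \<longleftrightarrow> \<bar>s\<bar> < R * sin \<alpha>"
      using assms(1) sin by (simp add: abs_le_square_iff[symmetric] flip: not_le)
    finally show ?thesis by auto
  qed
  have "dir \<phi> \<bullet> ?\<gamma> s = R * cos \<alpha>" for s
    by (simp add: inner_add_right inner_dir_dir inner_dir_perp)
  then have "?\<gamma> ` ?I \<subseteq> ?L" using in_ball by auto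
  moreover have "?L \<subseteq> ?\<gamma> ` ?I"
  proof
    fix x assume x: "x \<in> ?L"
    then have "x = ?\<gamma> (perp \<phi> \<bullet> x)" using dir_perp_expansion[of x \<phi>] by simp
    then show "x \<in> ?\<gamma> ` ?I" using in_ball x by (metis IntD1 image_eqI)
  qed
  ultimately show ?thesis by blast
qed

text \<open>The endpoints lie on the circle and on the line, so inside the open disk segment and
  line are the same set. This permits replacing segments by full lines.\<close>

lemma ball_inter_chord:
  fixes R \<alpha> \<phi> :: real
  assumes "R > 0" "0 < \<alpha>" "\<alpha> < pi"
  shows "ball 0 R \<inter> closed_segment (R *\<^sub>R dir (\<phi> - \<alpha>)) (R *\<^sub>R dir (\<phi> + \<alpha>)) =
    ball 0 R \<inter> {x. dir \<phi> \<bullet> x = R * cos \<alpha>}" (is "?L \<inter> ?S = ?L \<inter> ?H")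
proof -
  have sin: "R * sin \<alpha> > 0" using assms sin_gt_zero by simp
  then have "R \<noteq> 0" "sin \<alpha> \<noteq> 0" by auto
  have "?S \<subseteq> ?H"
    by (intro closed_segment_subset convex_hyperplane) (simp_all add: inner_dir_dir)
  moreover have "?L \<inter> ?H \<subseteq> ?S"
    unfolding ball_inter_line[OF assms]
  proof (rule image_subsetI)
    fix s assume s: "s \<in> {- (R * sin \<alpha>)<..<R * sin \<alpha>}"
    \<comment> \<open>The affine map taking the parameter range from
      \<open>- (R * sin \<alpha>)\<close> to \<open>R * sin \<alpha>\<close> onto the unit
      interval.\<close>
    define t where "t = (s + R * sin \<alpha>) / (2 * (R * sin \<alpha>))"
    have t: "0 \<le> t" "t \<le> 1" "s = (2 * t - 1) * (R * sin \<alpha>)"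
      using s sin \<open>R \<noteq> 0\<close> \<open>sin \<alpha> \<noteq> 0\<close> by (simp_all add: t_def field_simps)
    have "(R * cos \<alpha>) *\<^sub>R dir \<phi> + s *\<^sub>R perp \<phi> =
        (1 - t) *\<^sub>R R *\<^sub>R dir (\<phi> - \<alpha>) + t *\<^sub>R R *\<^sub>R dir (\<phi> + \<alpha>)"
      unfolding dir_add dir_diff t(3) by (simp add: vec_eq_iff algebra_simps)
    then show "(R * cos \<alpha>) *\<^sub>R dir \<phi> + s *\<^sub>R perp \<phi> \<in> ?S"
      unfolding in_segment using t by blast
  qed
  ultimately show ?thesis by blast
qed

text \<open>With \<open>\<alpha> = pi * p / q\<close> the endpoints have angles
  \<open>2 * (j - 1) * \<alpha>\<close> and \<open>2 * j * \<alpha>\<close>, so the chord is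
  symmetric about the direction \<open>(2 * j - 1) * \<alpha>\<close>.\<close>

lemma billiard_segment_eq:
  "billiard_segment R p q j =
    closed_segment (R *\<^sub>R dir ((2 * real j - 1) * (pi * real p / real q) - pi * real p / real q))
                   (R *\<^sub>R dir ((2 * real j - 1) * (pi * real p / real q) + pi * real p / real q))"
proof -
  have P: "billiard_point R q i = R *\<^sub>R dir (2 * pi * of_int i / real q)" for i
    by (simp add: billiard_point_def dir_def vec_eq_iff forall_2)
  have "2 * pi * of_int (int p * (int j - 1)) / real q =
        (2 * real j - 1) * (pi * real p / real q) - pi * real p / real q"
       "2 * pi * of_int (int p * int j) / real q =
        (2 * real j - 1) * (pi * real p / real q) + pi * real p / real q"
    by (simp_all add: field_simps diff_divide_distrib)
  then show ?thesis
    unfolding billiard_segment_def P by presburger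
qed

section \<open>Which pairs of chords cross inside the disk\<close>

lemma tan_half_quotient:
  fixes x :: real
  assumes "sin (2 * x) \<noteq> 0"
  shows "(1 - cos (2 * x)) / sin (2 * x) = sin x / cos x"
proof -
  have "sin x \<noteq> 0" "cos x \<noteq> 0" using assms by (auto simp: sin_double)
  then show ?thesis
    unfolding sin_double cos_double_sin by (simp add: power2_eq_square)
qed

text \<open>For \<open>x = k * \<alpha>\<close> the quotient is the position on a chord at which the
  chord \<open>k\<close> steps earlier meets it. It equals
  \<open>- R * cos \<alpha> * tan x\<close>, so the crossing is inside iff
  \<open>\<bar>tan x\<bar> < tan \<alpha>\<close>; squaring gives the comparison of double-angle
  cosines.\<close>

lemma crossing_param_iff:
  fixes R \<alpha> x :: real
  assumes "R > 0" "sin \<alpha> > 0" "cos \<alpha> > 0" "sin (2 * x) \<noteq> 0"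
  shows "R * cos \<alpha> * (1 - cos (2 * x)) / - sin (2 * x) \<in> {- (R * sin \<alpha>)<..<R * sin \<alpha>}
    \<longleftrightarrow> cos (2 * \<alpha>) < cos (2 * x)" (is "?r \<in> _ \<longleftrightarrow> _")
proof -
  have x: "sin x \<noteq> 0" "cos x \<noteq> 0" using assms(4) by (auto simp: sin_double)
  have r: "?r = - (R * cos \<alpha> * (sin x / cos x))"
    unfolding tan_half_quotient[OF assms(4), symmetric] by simp
  have "y \<in> {- c<..<c} \<longleftrightarrow> \<bar>y\<bar> < c" for y c :: real
    by auto
  then have "?r \<in> {- (R * sin \<alpha>)<..<R * sin \<alpha>} \<longleftrightarrow> \<bar>?r\<bar> < R * sin \<alpha>" .
  also have "\<dots> \<longleftrightarrow> cos \<alpha> * \<bar>sin x\<bar> < sin \<alpha> * \<bar>cos x\<bar>"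
    unfolding r using assms x by (simp add: abs_mult field_simps)
  also have "\<dots> \<longleftrightarrow> (cos \<alpha> * \<bar>sin x\<bar>)\<^sup>2 < (sin \<alpha> * \<bar>cos x\<bar>)\<^sup>2"
    using assms(2,3) by (simp add: power_mono_iff flip: not_le)
  also have "\<dots> \<longleftrightarrow> (cos \<alpha>)\<^sup>2 * (1 - (cos x)\<^sup>2) < (1 - (cos \<alpha>)\<^sup>2) * (cos x)\<^sup>2"
    by (simp add: power_mult_distrib sin_squared_eq)
  also have "\<dots> \<longleftrightarrow> cos (2 * \<alpha>) < cos (2 * x)"
    unfolding cos_double_cos by (simp add: algebra_simps)
  finally show ?thesis .
qed

text \<open>Substituting \<open>2 * p = q - 1\<close> reduces the angle, up to a multiple of
  \<open>pi\<close>, to \<open>- k * pi / q\<close>, whose size lies between \<open>0\<close> and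
  \<open>pi\<close> for the relevant \<open>k\<close>.\<close>

lemma two_k_half_angle:
  assumes "q = 2 * p + 1"
  shows "2 * (real k * (pi * real p / real q)) = real k * pi - real k * pi / real q"
proof -
  have "real q > 0" using assms by simp
  have "2 * (real k * (pi * real p / real q)) = real k * pi * (2 * real p) / real q" by simp
  also have "2 * real p = real q - 1" using assms by simp
  also have "real k * pi * (real q - 1) / real q = real k * pi - real k * pi / real q"
    using \<open>real q > 0\<close> by (simp add: field_simps)
  finally show ?thesis .
qed

lemma cos_two_k_half_angle:
  assumes "q = 2 * p + 1"
  shows "cos (2 * (real k * (pi * real p / real q))) = (-1) ^ k * cos (real k * pi / real q)"
  unfolding two_k_half_angle[OF assms] by (simp add: cos_diff)

lemma pi_fraction_strict_mono:
  assumes "i < j" "0 < q"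
  shows "real i * pi / real q < real j * pi / real q"
  using assms by (intro divide_strict_right_mono mult_strict_right_mono) auto

text \<open>Used twice: two different chords are never parallel, and three are never
  concurrent.\<close>

lemma sin_two_k_half_angle_nonzero:
  assumes "q = 2 * p + 1" "0 < k" "k < q"
  shows "sin (2 * (real k * (pi * real p / real q))) \<noteq> 0"
proof -
  have "sin (real k * pi / real q) > 0"
    by (rule sin_gt_zero) (use assms pi_fraction_strict_mono[of k q q] in auto)
  then show ?thesis
    unfolding two_k_half_angle[OF assms(1)] by (simp add: sin_diff)
qed

text \<open>The left side is \<open>- cos (pi / q)\<close>. For \<open>k = 1\<close> and
  \<open>k = q - 1\<close> the right side has this same value, so the strict inequality fails; for
  \<open>k\<close> in between its absolute value is below \<open>cos (pi / q)\<close>.\<close>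

lemma chords_cross_iff:
  assumes q: "q = 2 * p + 1" and k: "0 < k" "k < q"
  shows "cos (2 * (pi * real p / real q)) < cos (2 * (real k * (pi * real p / real q)))
    \<longleftrightarrow> 1 < k \<and> k < q - 1"
proof -
  have 1: "cos (2 * (pi * real p / real q)) = - cos (pi / real q)"
    using cos_two_k_half_angle[OF q, of 1] by simp
  have last: "cos (real (q - 1) * pi / real q) = - cos (pi / real q)"
  proof -
    have "real (q - 1) * pi / real q = pi - pi / real q"
      using q by (simp add: field_simps)
    then show ?thesis by simp
  qed
  consider "k = 1" | "k = q - 1" | "1 < k" "k < q - 1" using k by linarith
  then show ?thesis
  proof cases
    case 1
    then show ?thesis by simp
  next
    case 2
    \<comment> \<open>Here \<open>k = 2 * p\<close>, so the sign \<open>(-1) ^ k\<close> is positive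
      and the two cosines agree.\<close>
    moreover have "even k" using 2 q by simp
    ultimately show ?thesis
      unfolding cos_two_k_half_angle[OF q] 1 using last by simp
  next
    case 3
    have q0: "0 < q" "real q * pi / real q = pi" using q by simp_all
    have "cos (real k * pi / real q) < cos (pi / real q)"
      using pi_fraction_strict_mono[OF 3(1) q0(1)] pi_fraction_strict_mono[OF k(2) q0(1)] q0(2)
      by (intro cos_monotone_0_pi) auto
    moreover have "cos (real (q - 1) * pi / real q) < cos (real k * pi / real q)"
    proof (rule cos_monotone_0_pi)
      show "real (q - 1) * pi / real q \<le> pi"
        using pi_fraction_strict_mono[of "q - 1" q q] q0 by simp
    qed (use pi_fraction_strict_mono[OF 3(2) q0(1)] in auto)
    \<comment> \<open>Bounding the absolute value settles both signs of \<open>(-1) ^ k\<close> at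
      once.\<close>
    ultimately have "\<bar>cos (real k * pi / real q)\<bar> < cos (pi / real q)"
      using last by linarith
    then show ?thesis
      unfolding cos_two_k_half_angle[OF q] 1 using 3 by (cases "even k") auto
  qed
qed

section \<open>Counting the regions chord by chord\<close>

text \<open>Parametrised by arc length, chord \<open>m\<close> becomes an interval and every earlier
  chord a point on its line. The points inside the interval are the crossings, and they are pairwise
  distinct.\<close>

lemma card_sign_cells_chord:
  fixes R :: real
  assumes "R > 0" and q: "q = 2 * p + 1" and "p \<ge> 1" and m: "1 \<le> m" "m \<le> q"
  defines "\<alpha> \<equiv> pi * real p / real q"
  defines "a \<equiv> \<lambda>j. dir ((2 * real j - 1) * \<alpha>)" and "b \<equiv> \<lambda>j. R * cos \<alpha>"
  shows "card (sign_cells a b {1..<m} (ball 0 R \<inter> {x. a m \<bullet> x = b m})) =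
    Suc (card {j\<in>{1..<m}. 1 < m - j \<and> m - j < q - 1})"
proof -
  have \<alpha>: "0 < \<alpha>" "\<alpha> < pi / 2"
    using assms by (auto simp: field_simps)
  then have pos: "sin \<alpha> > 0" "cos \<alpha> > 0"
    by (auto intro!: sin_gt_zero cos_gt_zero)
  define I where "I = {- (R * sin \<alpha>)<..<R * sin \<alpha>}"
  \<comment> \<open>Slope and offset of the affine function that chord \<open>j\<close> induces on
    chord \<open>m\<close>, from the inner products of \<open>dir\<close> at angle
    \<open>(2 * j - 1) * \<alpha>\<close> with the frame of chord \<open>m\<close>.\<close>
  define a' where "a' j = - sin (2 * (real (m - j) * \<alpha>))" for j
  define b' where "b' j = R * cos \<alpha> * (1 - cos (2 * (real (m - j) * \<alpha>)))" for j
  have a'0: "a' j \<noteq> 0" if "j \<in> {1..<m}" for j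
  proof -
    have "0 < m - j" "m - j < q" using that m by auto
    from sin_two_k_half_angle_nonzero[OF q this] show ?thesis
      unfolding a'_def \<alpha>_def neg_equal_0_iff_equal .
  qed
  have "sign_cells a b {1..<m} (ball 0 R \<inter> {x. a m \<bullet> x = b m}) =
      sign_cells a b {1..<m} ((\<lambda>s. (R * cos \<alpha>) *\<^sub>R a m + s *\<^sub>R perp ((2 * real m - 1) * \<alpha>)) ` I)"
    unfolding a_def b_def I_def by (subst ball_inter_line) (use assms(1) \<alpha> in auto)
  also have "\<dots> = sign_cells a' b' {1..<m} I"
  proof (rule sign_cells_image)
    fix j s assume j: "j \<in> {1..<m}"
    then have diff: "(2 * real j - 1) * \<alpha> - (2 * real m - 1) * \<alpha> = - (2 * (real (m - j) * \<alpha>))"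
      by (simp add: of_nat_diff algebra_simps)
    show "a j \<bullet> ((R * cos \<alpha>) *\<^sub>R a m + s *\<^sub>R perp ((2 * real m - 1) * \<alpha>)) - b j =
        a' j \<bullet> s - b' j"
      unfolding a_def b_def a'_def b'_def inner_add_right inner_scaleR_right inner_dir_dir
        inner_dir_perp diff
      by (simp add: algebra_simps)
  qed
  also have "card \<dots> = Suc (card {j\<in>{1..<m}. b' j / a' j \<in> I})"
    unfolding I_def
  proof (rule card_sign_cells_interval)
    show "- (R * sin \<alpha>) < R * sin \<alpha>" using pos assms(1) by simp
    show "inj_on (\<lambda>j. b' j / a' j) {j\<in>{1..<m}. b' j / a' j \<in> {- (R * sin \<alpha>)<..<R * sin \<alpha>}}"
    proof (rule inj_onI)
      \<comment> \<open>Equal crossing positions mean \<open>tan x = tan y\<close>, hence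
        \<open>sin (x - y) = 0\<close> with \<open>x - y = (j - i) * \<alpha>\<close>; doubling the
        angle contradicts the nonvanishing sine.\<close>
      have wlog: False if ij: "i \<in> {1..<m}" "j \<in> {1..<m}" "i < j" "b' i / a' i = b' j / a' j" for i j
      proof -
        define x where "x = real (m - i) * \<alpha>"
        define y where "y = real (m - j) * \<alpha>"
        have s: "sin (2 * x) \<noteq> 0" "sin (2 * y) \<noteq> 0"
          using a'0 ij by (auto simp: a'_def x_def y_def)
        have K: "- (R * cos \<alpha>) \<noteq> 0" using assms(1) pos by simp
        have "- (R * cos \<alpha>) * ((1 - cos (2 * x)) / sin (2 * x)) =
            - (R * cos \<alpha>) * ((1 - cos (2 * y)) / sin (2 * y))"
          using ij(4) by (simp add: a'_def b'_def x_def y_def)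
        then have "sin x / cos x = sin y / cos y"
          unfolding tan_half_quotient[OF s(1)] tan_half_quotient[OF s(2)] mult_left_cancel[OF K] .
        moreover have "cos x \<noteq> 0" "cos y \<noteq> 0" using s by (auto simp: sin_double)
        ultimately have "sin (x - y) = 0" by (simp add: sin_diff field_simps)
        moreover have "x - y = real (j - i) * \<alpha>"
          using ij by (simp add: x_def y_def of_nat_diff algebra_simps)
        ultimately have "sin (2 * (real (j - i) * \<alpha>)) = 0" by (simp add: sin_double)
        moreover have "0 < j - i" "j - i < q" using ij m by auto
        ultimately show False
          using sin_two_k_half_angle_nonzero[OF q] unfolding \<alpha>_def by blast
      qed
      fix i j
      assume "i \<in> {j\<in>{1..<m}. b' j / a' j \<in> {- (R * sin \<alpha>)<..<R * sin \<alpha>}}"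
        "j \<in> {j\<in>{1..<m}. b' j / a' j \<in> {- (R * sin \<alpha>)<..<R * sin \<alpha>}}"
        "b' i / a' i = b' j / a' j"
      then show "i = j" using wlog[of i j] wlog[of j i] by (cases i j rule: linorder_cases) auto
    qed
  qed (use a'0 in auto)
  also have "{j\<in>{1..<m}. b' j / a' j \<in> I} = {j\<in>{1..<m}. 1 < m - j \<and> m - j < q - 1}"
  proof (rule Collect_cong, rule conj_cong[OF refl])
    fix j assume j: "j \<in> {1..<m}"
    have "b' j / a' j \<in> I \<longleftrightarrow> cos (2 * \<alpha>) < cos (2 * (real (m - j) * \<alpha>))"
      unfolding I_def a'_def b'_def
      by (rule crossing_param_iff) (use assms(1) pos a'0[OF j] in \<open>auto simp: a'_def\<close>)
    also have "\<dots> \<longleftrightarrow> 1 < m - j \<and> m - j < q - 1"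
      unfolding \<alpha>_def by (rule chords_cross_iff[OF q]) (use j m in auto)
    finally show "b' j / a' j \<in> I \<longleftrightarrow> 1 < m - j \<and> m - j < q - 1" .
  qed
  finally show ?thesis .
qed

text \<open>The first chord adds one region. Chord \<open>n + 1\<close> adds \<open>n\<close>
  regions for \<open>1 \<le> n < q - 1\<close>, since it misses only its predecessor, and the last
  one adds \<open>n - 1\<close>, since it also misses the first chord.\<close>

lemma card_sign_cells_chords:
  fixes R :: real
  assumes "R > 0" and q: "q = 2 * p + 1" and "p \<ge> 1" and "n \<le> q"
  defines "\<alpha> \<equiv> pi * real p / real q"
  defines "a \<equiv> \<lambda>j. dir ((2 * real j - 1) * \<alpha>)" and "b \<equiv> \<lambda>j. R * cos \<alpha>"
  shows "real (card (sign_cells a b {1..n} (ball 0 R))) =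
    2 - (kronecker_delta n 0 + kronecker_delta n q) + real n * (real n - 1) / 2"
  using \<open>n \<le> q\<close>
proof (induction n)
  case 0
  then show ?case
    using assms(1) q by (simp add: sign_cells_empty_index kronecker_delta_def)
next
  case (Suc n)
  \<comment> \<open>Since \<open>n < q\<close>, the second Kronecker delta vanishes.\<close>
  have IH: "real (card (sign_cells a b {1..n} (ball 0 R))) =
    2 - kronecker_delta n 0 + real n * (real n - 1) / 2"
    using Suc by (simp add: kronecker_delta_def)
  have ins: "{1..Suc n} = insert (Suc n) {1..n}" by auto
  have n: "{1..<Suc n} = {1..n}" by auto
  have "card (sign_cells a b {1..Suc n} (ball 0 R)) = card (sign_cells a b {1..n} (ball 0 R)) +
      card (sign_cells a b {1..n} (ball 0 R \<inter> {x. a (Suc n) \<bullet> x = b (Suc n)}))"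
    unfolding ins by (rule card_sign_cells_insert) (auto simp: a_def dir_nonzero)
  also have "card (sign_cells a b {1..n} (ball 0 R \<inter> {x. a (Suc n) \<bullet> x = b (Suc n)})) =
      Suc (card {j\<in>{1..n}. 1 < Suc n - j \<and> Suc n - j < q - 1})"
    using card_sign_cells_chord[OF assms(1) q assms(3), of "Suc n"] Suc.prems
    unfolding n a_def b_def \<alpha>_def by simp
  finally have step: "card (sign_cells a b {1..Suc n} (ball 0 R)) =
    card (sign_cells a b {1..n} (ball 0 R)) +
    Suc (card {j\<in>{1..n}. 1 < Suc n - j \<and> Suc n - j < q - 1})" .
  show ?case
  proof (cases "Suc n = q")
    case True
    \<comment> \<open>The closing chord shares an endpoint with both chord \<open>n\<close> and
      chord \<open>1\<close>, so both drop out.\<close>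
    then have "{j\<in>{1..n}. 1 < Suc n - j \<and> Suc n - j < q - 1} = {2..<n}" by auto
    then show ?thesis
      unfolding step of_nat_add IH using True q assms(3)
      by (simp add: kronecker_delta_def of_nat_diff field_simps)
  next
    case False
    then have "{j\<in>{1..n}. 1 < Suc n - j \<and> Suc n - j < q - 1} = {1..<n}" using Suc.prems by auto
    then show ?thesis
      unfolding step of_nat_add IH using False
      \<comment> \<open>For \<open>n = 0\<close> the increment is \<open>1\<close> rather than
        \<open>n\<close>; the vanishing of the delta at \<open>0\<close> supplies it.\<close>
      by (cases "n = 0") (simp_all add: kronecker_delta_def of_nat_diff field_simps)
  qed
qed

theorem mainTheorem1:
  fixes R :: real and p n :: nat
  assumes "R > 0" and "p \<ge> 1" and "n \<le> 2 * p + 1"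
  shows "real (billiard_regions R p (2 * p + 1) n)
           = 2 - (kronecker_delta n 0 + kronecker_delta n (2 * p + 1)) + (\<Sum>i = 1..n - 1. real i)
       \<and> 2 - (kronecker_delta n 0 + kronecker_delta n (2 * p + 1)) + (\<Sum>i = 1..n - 1. real i)
           = 2 - (kronecker_delta n 0 + kronecker_delta n (2 * p + 1)) + real n * (real n - 1) / 2"
proof -
  define q where "q = 2 * p + 1"
  define \<alpha> where "\<alpha> = pi * real p / real q"
  define a where "a j = dir ((2 * real j - 1) * \<alpha>)" for j :: nat
  have \<alpha>: "0 < \<alpha>" "\<alpha> < pi"
    using assms by (auto simp: \<alpha>_def q_def field_simps intro!: add_pos_nonneg)
  \<comment> \<open>Segments give way to full lines, which makes the arrangement count
    applicable.\<close>
  have "ball 0 R - (\<Union>j\<in>{1..n}. billiard_segment R p q j) =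
      ball 0 R - (\<Union>j\<in>{1..n}. {x. a j \<bullet> x = R * cos \<alpha>})"
    using ball_inter_chord[OF assms(1) \<alpha>]
    unfolding billiard_segment_eq a_def \<alpha>_def[symmetric] by blast
  then have regions: "real (billiard_regions R p q n) =
      2 - (kronecker_delta n 0 + kronecker_delta n q) + real n * (real n - 1) / 2"
    unfolding billiard_regions_def
    using card_components_sign_cells[where S = "ball 0 R" and J = "{1..n}" and a = a and
        b = "\<lambda>_. R * cos \<alpha>"]
      card_sign_cells_chords[OF assms(1) q_def assms(2), of n] assms(3)
    by (simp add: a_def[abs_def] \<alpha>_def q_def)
  have "(\<Sum>i = 1..k. real i) = real k * (real k + 1) / 2" for k
    by (induction k) (simp_all add: field_simps)
  \<comment> \<open>At \<open>n = 0\<close> the truncated \<open>n - 1\<close> gives an empty sum,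
    in agreement with the factor \<open>real n\<close>.\<close>
  from this[of "n - 1"] have "(\<Sum>i = 1..n - 1. real i) = real n * (real n - 1) / 2"
    by (cases n) auto
  then show ?thesis
    using regions unfolding q_def by simp
qed

end
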